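(* Let $\chi\in\mathcal C_n$ be a complete simple game with two types of voters. Then $\mu(\chi)\le\sqrt n+1$.
   Context: Let $N=\{1,\dots,n\}$. A simple game on $n$ voters is a function $\chi:2^N\to\{0,1\}$ with $\chi(\emptyset)=0$, $\chi(N)=1$ and $\chi(S)\le\chi(T)$ whenever $S\subseteq T\subseteq N$. A coalition $S$ is winning if $\chi(S)=1$ and losing if $\chi(S)=0$. For voters $i,j\in N$ write $i\sqsupset j$ if $\chi(\{i\}\cup S\setminus\{j\})\ge\chi(S)$ for all $S$ with $j\in S\subseteq N\setminus\{i\}$. The simple game is complete if $\sqsupset$ is a total preorder on $N$; $\mathcal C_n$ is the set of complete simple games on $n$ voters. Voters $i,j$ are equivalent if $i\sqsupset j$ and $j\sqsupset i$; the equivalence classes are the types of voters, so "two types of voters" means that there are exactly two equivalence classes. For real weights write $w(S)=\sum_{i\in S}w_i$. For real $\alpha\ge 1$, $\chi$ is $\alpha$-roughly weighted if there are $w_1,\dots,w_n\in\mathbb R$ with $w(S)\ge 1$ for all winning $S$ and $w(S)\le\alpha$ for all losing $S$. The critical threshold value $\mu(\chi)$ is the smallest $\alpha\ge 1$ such that $\chi$ is $\alpha$-roughly weighted. *)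

theory Defs
  imports Complex_Main
begin

definition voters :: "nat \<Rightarrow> nat set" where
  "voters n = {1..n}"

text \<open>
  A game on \<open>n\<close> voters is a function on coalitions, of which only the values on subsets of
  \<open>voters n\<close> matter; every definition below is relativised to these coalitions.
\<close>

definition simple_game :: "nat \<Rightarrow> (nat set \<Rightarrow> nat) \<Rightarrow> bool" where
  "simple_game n \<chi> \<longleftrightarrow>
     (\<forall>S \<subseteq> voters n. \<chi> S \<in> {0, 1}) \<and>
     \<chi> {} = 0 \<and> \<chi> (voters n) = 1 \<and>
     (\<forall>S T. S \<subseteq> T \<and> T \<subseteq> voters n \<longrightarrow> \<chi> S \<le> \<chi> T)"

definition winning :: "nat \<Rightarrow> (nat set \<Rightarrow> nat) \<Rightarrow> nat set \<Rightarrow> bool" where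
  "winning n \<chi> S \<longleftrightarrow> S \<subseteq> voters n \<and> \<chi> S = 1"

definition losing :: "nat \<Rightarrow> (nat set \<Rightarrow> nat) \<Rightarrow> nat set \<Rightarrow> bool" where
  "losing n \<chi> S \<longleftrightarrow> S \<subseteq> voters n \<and> \<chi> S = 0"

text \<open>
  The pair \<open>(i, j)\<close> belongs to the relation iff \<open>i\<close> is at least as influential as \<open>j\<close>, so the
  larger element comes first.  For \<open>i = j\<close> no coalition \<open>S\<close> qualifies and the condition is vacuous.
\<close>

definition desirability :: "nat \<Rightarrow> (nat set \<Rightarrow> nat) \<Rightarrow> (nat \<times> nat) set" where
  "desirability n \<chi> =
     {(i, j). i \<in> voters n \<and> j \<in> voters n \<and>
        (\<forall>S. j \<in> S \<and> S \<subseteq> voters n - {i} \<longrightarrow> \<chi> ({i} \<union> (S - {j})) \<ge> \<chi> S)}"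

definition complete_simple_game :: "nat \<Rightarrow> (nat set \<Rightarrow> nat) \<Rightarrow> bool" where
  "complete_simple_game n \<chi> \<longleftrightarrow>
     simple_game n \<chi> \<and>
     preorder_on (voters n) (desirability n \<chi>) \<and>
     total_on (voters n) (desirability n \<chi>)"

definition voter_types :: "nat \<Rightarrow> (nat set \<Rightarrow> nat) \<Rightarrow> nat set set" where
  "voter_types n \<chi> = voters n // (desirability n \<chi> \<inter> (desirability n \<chi>)\<inverse>)"

definition roughly_weighted :: "nat \<Rightarrow> (nat set \<Rightarrow> nat) \<Rightarrow> real \<Rightarrow> bool" where
  "roughly_weighted n \<chi> \<alpha> \<longleftrightarrow>
     (\<exists>w :: nat \<Rightarrow> real.
        (\<forall>S. winning n \<chi> S \<longrightarrow> (\<Sum>i\<in>S. w i) \<ge> 1) \<and>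
        (\<forall>S. losing n \<chi> S \<longrightarrow> (\<Sum>i\<in>S. w i) \<le> \<alpha>))"

text \<open>
  The minimum is attained for every simple game: negative weights may be replaced by \<open>0\<close>
  and weights above \<open>\<alpha>\<close> by \<open>\<alpha>\<close>, so the weights may be taken from a compact set.
\<close>

definition critical_threshold :: "nat \<Rightarrow> (nat set \<Rightarrow> nat) \<Rightarrow> real" where
  "critical_threshold n \<chi> = (LEAST \<alpha>. \<alpha> \<ge> 1 \<and> roughly_weighted n \<chi> \<alpha>)"

end

theory Submission
  imports Defs "HOL-Analysis.Function_Topology"
begin

text \<open>
  Let \<open>A\<close> be the type of the stronger voters, \<open>B\<close> the other one, and let \<open>m\<close> be the least size of a
  winning coalition.  If \<open>m \<ge> sqrt n\<close>, the constant weight \<open>1 / m\<close> gives every coalition weight at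
  most \<open>n / m \<le> sqrt n\<close>.  Otherwise give weight \<open>1\<close> to the voters of \<open>A\<close>, and weight \<open>1 / t\<close>
  to those of \<open>B\<close>, where \<open>t\<close> is the least size of a winning coalition inside \<open>B\<close> (weight \<open>0\<close>
  if there is none).  Exchanging voters one at a time shows that a losing coalition contains
  fewer than \<open>m\<close> voters of \<open>A\<close> and fewer than \<open>t\<close> voters of \<open>B\<close>, so its weight is
  below \<open>m < sqrt n\<close>.
\<close>

section \<open>Winning and losing coalitions under inclusion and exchange\<close>

lemma finite_voters [simp]: "finite (voters n)"
  by (simp add: voters_def)

lemma card_voters [simp]: "card (voters n) = n"
  by (simp add: voters_def)

lemma winning_finite: "winning n \<chi> S \<Longrightarrow> finite S"
  using finite_subset[OF _ finite_voters] by (auto simp: winning_def)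

lemma winning_superset:
  assumes "simple_game n \<chi>" "winning n \<chi> S" "S \<subseteq> T" "T \<subseteq> voters n"
  shows "winning n \<chi> T"
proof -
  have "\<chi> S \<le> \<chi> T" "\<chi> T \<in> {0, 1}"
    using assms unfolding simple_game_def by blast+
  then show ?thesis
    using assms by (auto simp: winning_def)
qed

lemma losing_subset:
  assumes "simple_game n \<chi>" "losing n \<chi> T" "S \<subseteq> T"
  shows "losing n \<chi> S"
proof -
  have "\<chi> S \<le> \<chi> T"
    using assms unfolding simple_game_def losing_def by blast
  then show ?thesis
    using assms by (auto simp: losing_def)
qed

lemma losing_not_winning: "losing n \<chi> S \<Longrightarrow> \<not> winning n \<chi> S"
  by (simp add: losing_def winning_def)

lemma winning_nonempty: "simple_game n \<chi> \<Longrightarrow> winning n \<chi> S \<Longrightarrow> S \<noteq> {}"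
  by (auto simp: simple_game_def winning_def)

lemma winning_voters: "simple_game n \<chi> \<Longrightarrow> winning n \<chi> (voters n)"
  by (simp add: simple_game_def winning_def)

lemma winning_exchange:
  assumes "simple_game n \<chi>" "winning n \<chi> S" "(i, j) \<in> desirability n \<chi>" "j \<in> S" "i \<notin> S"
  shows "winning n \<chi> (insert i (S - {j}))"
proof -
  have i: "i \<in> voters n" and S: "S \<subseteq> voters n"
    using assms by (auto simp: desirability_def winning_def)
  have "\<chi> S \<le> \<chi> ({i} \<union> (S - {j}))"
    using assms S unfolding desirability_def by blast
  moreover have "insert i (S - {j}) \<subseteq> voters n"
    using i S by auto
  moreover from this have "\<chi> (insert i (S - {j})) \<in> {0, 1}"
    using assms(1) by (simp add: simple_game_def)
  ultimately show ?thesis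
    using assms(2) by (auto simp: winning_def)
qed

text \<open>Swapping a voter of \<open>M - P\<close> for one of \<open>P - M\<close> keeps the
  coalition winning and its size fixed, and shrinks \<open>M - P\<close>. Since no new voter enters
  \<open>M - P\<close>, the hypothesis on desirability survives; once
  \<open>M \<subseteq> P\<close>, monotonicity finishes.\<close>

lemma winning_dominating:
  assumes game: "simple_game n \<chi>" and "winning n \<chi> M" and P: "P \<subseteq> voters n"
    and "card M \<le> card P" and "\<And>i j. i \<in> P \<Longrightarrow> j \<in> M - P \<Longrightarrow> (i, j) \<in> desirability n \<chi>"
  shows "winning n \<chi> P"
  using assms(2,4,5)
proof (induction "card (M - P)" arbitrary: M rule: less_induct)
  case less
  have fin: "finite M" "finite P"
    using winning_finite less.prems P finite_subset finite_voters by blast+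
  show ?case
  proof (cases "M \<subseteq> P")
    case True
    then show ?thesis
      using winning_superset game less.prems P by blast
  next
    case False
    then obtain j where j: "j \<in> M" "j \<notin> P" by blast
    \<comment> \<open>Otherwise \<open>card M \<le> card P\<close> would force \<open>P = M\<close>,
      against \<open>j\<close>.\<close>
    have "\<not> P \<subseteq> M"
      using less.prems(2) j fin by (metis card_seteq)
    then obtain i where i: "i \<in> P" "i \<notin> M" by blast
    let ?M = "insert i (M - {j})"
    have fewer: "card (?M - P) < card (M - P)"
      using i j fin by (intro psubset_card_mono) auto
    have win: "winning n \<chi> ?M"
      using winning_exchange[OF game less.prems(1)] less.prems(3) i j by blast
    have card: "card ?M \<le> card P"
      using i j fin less.prems(2) by (metis DiffD1 card.remove card_insert_disjoint finite_Diff)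
    show ?thesis
      using less.hyps[OF fewer win card] less.prems(3) i by blast
  qed
qed

section \<open>The minimum defining the critical threshold is attained\<close>

lemma roughly_weighted_bounded:
  assumes game: "simple_game n \<chi>" and C: "1 \<le> C" "\<alpha> \<le> C" and "roughly_weighted n \<chi> \<alpha>"
  obtains w :: "nat \<Rightarrow> real" where "\<And>i. w i \<in> {0..C}"
    "\<And>S. winning n \<chi> S \<Longrightarrow> 1 \<le> sum w S" "\<And>S. losing n \<chi> S \<Longrightarrow> sum w S \<le> \<alpha>"
proof -
  obtain w :: "nat \<Rightarrow> real" where w: "\<And>S. winning n \<chi> S \<Longrightarrow> 1 \<le> sum w S"
      "\<And>S. losing n \<chi> S \<Longrightarrow> sum w S \<le> \<alpha>"
    using assms(4) unfolding roughly_weighted_def by blast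
  \<comment> \<open>Cutting at \<open>C\<close> instead of \<alpha> puts the weights for all
    \<alpha> \<le> C into one common box.\<close>
  define v where "v i = max 0 (min C (w i))" for i
  have v: "v i \<in> {0..C}" for i
    using C by (simp add: v_def)
  have win: "1 \<le> sum v S" if S: "winning n \<chi> S" for S
  \<comment> \<open>A voter cut down to \<open>C \<ge> 1\<close> suffices alone; without such a
    voter, no weight in \<open>S\<close> has decreased.\<close>
  proof (cases "\<exists>i\<in>S. C \<le> w i")
    case True
    then obtain i where i: "i \<in> S" "C \<le> w i" by blast
    have "1 \<le> v i"
      using i C by (simp add: v_def)
    also have "v i \<le> sum v S"
      using i v winning_finite[OF S] by (intro member_le_sum) auto
    finally show ?thesis .
  next
    case False
    then have "sum w S \<le> sum v S"
      by (intro sum_mono) (force simp: v_def)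
    with w(1)[OF S] show ?thesis by simp
  qed
  have lose: "sum v S \<le> \<alpha>" if S: "losing n \<chi> S" for S
  proof -
    \<comment> \<open>Raising negative weights to 0 may increase the sum over \<open>S\<close>, so
      compare on the voters of positive weight: they still form a losing coalition, and there
      \<open>v \<le> w\<close>.\<close>
    let ?T = "{i \<in> S. 0 < w i}"
    have "finite S"
      using S finite_subset[OF _ finite_voters] by (auto simp: losing_def)
    then have "sum v S = sum v ?T"
      using C by (intro sum.mono_neutral_right) (auto simp: v_def)
    also have "\<dots> \<le> sum w ?T"
      by (intro sum_mono) (auto simp: v_def)
    also have "\<dots> \<le> \<alpha>"
      by (rule w(2), rule losing_subset[OF game S]) auto
    finally show ?thesis .
  qed
  show ?thesis
    using that v win lose by blast
qed

text \<open>Over the reals, \<open>LEAST\<close> is informative only if a least element exists.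
  Compactness supplies one: minimise the first coordinate over the pairs of a threshold and bounded
  weights realising it.\<close>

lemma critical_threshold_le:
  assumes game: "simple_game n \<chi>" and C: "1 \<le> C" "roughly_weighted n \<chi> C"
  shows "critical_threshold n \<chi> \<le> C"
proof -
  define F where "F = ({1..C} \<times> Pi\<^sub>E UNIV (\<lambda>_. {0..C})) \<inter>
    {p :: real \<times> (nat \<Rightarrow> real). (\<forall>S. winning n \<chi> S \<longrightarrow> 1 \<le> sum (snd p) S) \<and>
      (\<forall>S. losing n \<chi> S \<longrightarrow> sum (snd p) S \<le> fst p)}"
  have coord: "continuous_on UNIV (\<lambda>p :: real \<times> (nat \<Rightarrow> real). snd p i)" for i
    by (rule continuous_on_product_then_coordinatewise) (intro continuous_intros)
  have "compact (Pi\<^sub>E UNIV (\<lambda>_ :: nat. {0..C}))"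
    using compactin_PiE[of "\<lambda>_. euclidean" UNIV "\<lambda>_ :: nat. {0..C}"]
    by (simp add: euclidean_product_topology compactin_euclidean_iff compact_Icc)
  \<comment> \<open>The premises on \<open>S\<close> do not involve \<open>p\<close>, so each
    implication is either vacuous or a closed inequality between continuous functions.\<close>
  moreover have "closed {p :: real \<times> (nat \<Rightarrow> real).
      (\<forall>S. winning n \<chi> S \<longrightarrow> 1 \<le> sum (snd p) S) \<and> (\<forall>S. losing n \<chi> S \<longrightarrow> sum (snd p) S \<le> fst p)}"
    by (intro closed_Collect_conj closed_Collect_all closed_Collect_imp closed_Collect_le
        open_Collect_const continuous_intros coord)
  ultimately have "compact F"
    unfolding F_def by (intro compact_Int_closed compact_Times) auto
  moreover have in_F: "\<exists>w. (\<beta>, w) \<in> F" if \<beta>: "1 \<le> \<beta>" "\<beta> \<le> C" "roughly_weighted n \<chi> \<beta>" for \<beta>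
  proof -
    obtain w :: "nat \<Rightarrow> real" where "\<And>i. w i \<in> {0..C}"
        "\<And>S. winning n \<chi> S \<Longrightarrow> 1 \<le> sum w S" "\<And>S. losing n \<chi> S \<Longrightarrow> sum w S \<le> \<beta>"
      by (rule roughly_weighted_bounded[OF game C(1) \<beta>(2,3)], rule that)
    then show ?thesis
      using \<beta> by (auto simp: F_def PiE_iff)
  qed
  moreover have "F \<noteq> {}"
    using in_F[OF C(1) order_refl C(2)] by blast
  ultimately obtain p where p: "p \<in> F" "\<And>q. q \<in> F \<Longrightarrow> fst p \<le> fst q"
    using continuous_attains_inf[of F fst] C continuous_on_fst[OF continuous_on_id, of F]
    by blast
  have "1 \<le> fst p \<and> roughly_weighted n \<chi> (fst p)"
    using p(1) unfolding F_def roughly_weighted_def by auto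
  moreover have le: "fst p \<le> \<beta>" if "1 \<le> \<beta> \<and> roughly_weighted n \<chi> \<beta>" for \<beta>
  proof (cases "\<beta> \<le> C")
    case True
    then show ?thesis using in_F p(2) that by fastforce
  next
    case False
    moreover have "fst p \<le> C"
      using p(1) by (auto simp: F_def)
    ultimately show ?thesis by simp
  qed
  ultimately have "critical_threshold n \<chi> = fst p"
    unfolding critical_threshold_def by (intro Least_equality)
  then show ?thesis
    using le C by simp
qed

section \<open>The two types of voters, ordered by desirability\<close>

lemma two_types_cases:
  assumes "complete_simple_game n \<chi>" "card (voter_types n \<chi>) = 2"
  obtains A B where "A \<union> B = voters n" "A \<inter> B = {}"
    "\<And>i j. i \<in> A \<Longrightarrow> j \<in> voters n \<Longrightarrow> (i, j) \<in> desirability n \<chi>"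
    "\<And>i j. i \<in> B \<Longrightarrow> j \<in> B \<Longrightarrow> (i, j) \<in> desirability n \<chi>"
proof -
  let ?D = "desirability n \<chi>"
  let ?E = "?D \<inter> ?D\<inverse>"
  have refl: "refl_on (voters n) ?D" and trans: "trans ?D" and total: "total_on (voters n) ?D"
    using assms(1) by (auto simp: complete_simple_game_def preorder_on_def)
  have sub: "?D \<subseteq> voters n \<times> voters n"
    by (auto simp: desirability_def)
  have equiv: "equiv (voters n) ?E"
    using refl trans sub
    by (intro equivI) (auto simp: refl_on_def sym_def intro!: trans_Int)
  obtain X Y where XY: "voters n // ?E = {X, Y}" "X \<noteq> Y"
    using assms(2) by (auto simp: voter_types_def card_2_iff)
  have union: "X \<union> Y = voters n" and disj: "X \<inter> Y = {}"
    using Union_quotient[OF equiv] quotient_disj[OF equiv, of X Y] XY by auto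
  have same: "(i, j) \<in> ?D" if "Z \<in> {X, Y}" "i \<in> Z" "j \<in> Z" for Z i j
    using in_quotient_imp_in_rel[OF equiv, of Z i j] XY that by auto
  obtain x y where xy: "x \<in> X" "y \<in> Y"
    using in_quotient_imp_non_empty[OF equiv, of X] in_quotient_imp_non_empty[OF equiv, of Y] XY(1)
    by auto
  \<comment> \<open>Comparing one representative of each class is enough: transitivity carries the
    result to all pairs, and the stronger class becomes \<open>A\<close>.\<close>
  then have "(x, y) \<in> ?D \<or> (y, x) \<in> ?D"
    using total union disj by (metis IntI UnI1 UnI2 empty_iff total_on_def)
  then show ?thesis
  proof
    assume "(x, y) \<in> ?D"
    then have "(i, j) \<in> ?D" if "i \<in> X" "j \<in> voters n" for i j
    proof (cases "j \<in> X")
      case True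
      then show ?thesis using that same[of X i j] by simp
    next
      case False
      then have "(i, x) \<in> ?D" "(y, j) \<in> ?D"
        using that union xy same[of X i x] same[of Y y j] by auto
      with \<open>(x, y) \<in> ?D\<close> show ?thesis by (meson trans transD)
    qed
    moreover have "(i, j) \<in> ?D" if "i \<in> Y" "j \<in> Y" for i j
      using same[of Y i j] that by simp
    ultimately show ?thesis
      using that[OF union disj] by simp
  next
    assume "(y, x) \<in> ?D"
    then have "(i, j) \<in> ?D" if "i \<in> Y" "j \<in> voters n" for i j
    proof (cases "j \<in> Y")
      case True
      then show ?thesis using that same[of Y i j] by simp
    next
      case False
      then have "(i, y) \<in> ?D" "(x, j) \<in> ?D"
        using that union xy same[of Y i y] same[of X x j] by auto
      with \<open>(y, x) \<in> ?D\<close> show ?thesis by (meson trans transD)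
    qed
    moreover have "(i, j) \<in> ?D" if "i \<in> X" "j \<in> X" for i j
      using same[of X i j] that by simp
    ultimately show ?thesis
      using that[of Y X] union disj by (simp add: Un_commute Int_commute)
  qed
qed

theorem lemma12:
  fixes n :: nat and \<chi> :: "nat set \<Rightarrow> nat"
  assumes "complete_simple_game n \<chi>"
    and "card (voter_types n \<chi>) = 2"
  shows "critical_threshold n \<chi> \<le> sqrt (real n) + 1"
proof -
  have game: "simple_game n \<chi>"
    using assms(1) by (simp add: complete_simple_game_def)
  obtain M where M: "winning n \<chi> M" "\<And>S. winning n \<chi> S \<Longrightarrow> card M \<le> card S"
    using ex_has_least_nat[of "winning n \<chi>" _ card] winning_voters[OF game] by metis
  have m: "0 < card M"
    using M(1) winning_finite winning_nonempty[OF game] by (metis card_gt_0_iff)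
  have "roughly_weighted n \<chi> (sqrt n + 1)"
  proof (cases "sqrt n \<le> card M")
    case True
    let ?w = "\<lambda>_ :: nat. 1 / real (card M)"
    have "1 \<le> sum ?w S" if "winning n \<chi> S" for S
      using M(2)[OF that] m by (simp add: field_simps)
    moreover have "sum ?w S \<le> sqrt n + 1" if "losing n \<chi> S" for S
    proof -
      \<comment> \<open>The target is
        \<open>card S \<le> n = sqrt n * sqrt n \<le> sqrt n * card M\<close>.\<close>
      have "card S \<le> n"
        using that card_mono[OF finite_voters[of n]] by (auto simp: losing_def)
      then have "real (card S) \<le> sqrt n * sqrt n" by simp
      also have "\<dots> \<le> sqrt n * card M"
        using True by (intro mult_left_mono) auto
      finally have "sum ?w S \<le> sqrt n"
        using m by (simp add: field_simps)
      then show ?thesis by simp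
    qed
    ultimately show ?thesis
      unfolding roughly_weighted_def by blast
  next
    case False
    obtain A B where AB: "A \<union> B = voters n" "A \<inter> B = {}"
      and A: "\<And>i j. i \<in> A \<Longrightarrow> j \<in> voters n \<Longrightarrow> (i, j) \<in> desirability n \<chi>"
      and B: "\<And>i j. i \<in> B \<Longrightarrow> j \<in> B \<Longrightarrow> (i, j) \<in> desirability n \<chi>"
      by (rule two_types_cases[OF assms], rule that)
    \<comment> \<open>If \<open>S \<inter> Z\<close> were at least as large as \<open>T\<close>, it
      would win by exchanges, although it lies in the losing \<open>S\<close>. For
      \<open>Z = A\<close> any winning \<open>T\<close> is dominated, hence \<open>M\<close>; for
      \<open>Z = B\<close> take \<open>T\<close> inside \<open>B\<close>.\<close>
    have few: "card (S \<inter> Z) < card T"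
      if "losing n \<chi> S" "winning n \<chi> T" "Z \<subseteq> voters n"
        and "\<And>i j. i \<in> Z \<Longrightarrow> j \<in> T \<Longrightarrow> (i, j) \<in> desirability n \<chi>" for S T Z
    proof (rule ccontr)
      assume "\<not> card (S \<inter> Z) < card T"
      then have "winning n \<chi> (S \<inter> Z)"
        using that(3,4) by (intro winning_dominating[OF game that(2)]) auto
      moreover have "losing n \<chi> (S \<inter> Z)"
        by (rule losing_subset[OF game that(1)]) simp
      ultimately show False
        using losing_not_winning by blast
    qed
    have few_A: "card (S \<inter> A) < card M" if "losing n \<chi> S" for S
      using few[OF that M(1), of A] A AB M(1) unfolding winning_def by blast
    \<comment> \<open>\<open>v\<close> is the weight of a voter of \<open>B\<close>. If no coalition
      inside \<open>B\<close> wins, \<open>v = 0\<close> makes \<open>win_B\<close> vacuous and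
      \<open>lose_B\<close> trivial.\<close>
    obtain v :: real where v: "0 \<le> v"
      and win_B: "\<And>S. winning n \<chi> S \<Longrightarrow> S \<subseteq> B \<Longrightarrow> 1 \<le> v * card S"
      and lose_B: "\<And>S. losing n \<chi> S \<Longrightarrow> v * card (S \<inter> B) \<le> 1"
    proof (cases "\<exists>T. winning n \<chi> T \<and> T \<subseteq> B")
      case True
      then obtain T where T: "winning n \<chi> T" "T \<subseteq> B"
        "\<And>S. winning n \<chi> S \<Longrightarrow> S \<subseteq> B \<Longrightarrow> card T \<le> card S"
        using ex_has_least_nat[of "\<lambda>T. winning n \<chi> T \<and> T \<subseteq> B" _ card] by metis
      have t: "0 < card T"
        using T(1) winning_finite winning_nonempty[OF game] by (metis card_gt_0_iff)
      have "1 \<le> 1 / card T * card S" if "winning n \<chi> S" "S \<subseteq> B" for S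
        using T(3)[OF that] t by (simp add: field_simps)
      moreover have "1 / card T * card (S \<inter> B) \<le> 1" if "losing n \<chi> S" for S
      proof -
        have "card (S \<inter> B) < card T"
          using few[OF that T(1), of B] B AB T(2) by blast
        then show ?thesis
          using t by (simp add: field_simps)
      qed
      ultimately show ?thesis
        using that[of "1 / card T"] by simp
    next
      case False
      then show ?thesis using that[of 0] by auto
    qed
    let ?w = "\<lambda>i. if i \<in> A then 1 else v"
    have weight: "sum ?w S = card (S \<inter> A) + v * card (S \<inter> B)" if "S \<subseteq> voters n" for S
    proof -
      have fin: "finite S"
        using that finite_subset finite_voters by blast
      have "S \<inter> - A = S \<inter> B"
        using that AB by blast
      then show ?thesis
        using fin by (simp add: sum.If_cases)
    qed
    have "1 \<le> sum ?w S" if S: "winning n \<chi> S" for S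
    \<comment> \<open>A winning coalition not inside \<open>B\<close> contains a voter of
      \<open>A\<close>, whose weight is already 1.\<close>
    proof (cases "S \<subseteq> B")
      case True
      then have "S \<inter> B = S" by blast
      then show ?thesis
        using win_B[OF S True] S weight[of S] by (simp add: winning_def)
    next
      case False
      then have "S \<inter> A \<noteq> {}"
        using S AB by (auto simp: winning_def)
      then have "1 \<le> card (S \<inter> A)"
        using winning_finite[OF S] by (simp add: Suc_le_eq card_gt_0_iff)
      then show ?thesis
        using S v weight[of S] by (simp add: winning_def add_increasing2)
    qed
    \<comment> \<open>The part in \<open>A\<close> weighs less than \<open>card M < sqrt n\<close>;
      the summand 1 covers the part in \<open>B\<close>.\<close>
    moreover have "sum ?w S \<le> sqrt n + 1" if S: "losing n \<chi> S" for S
      using few_A[OF S] lose_B[OF S] False S weight[of S] by (simp add: losing_def)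
    ultimately show ?thesis
      unfolding roughly_weighted_def by blast
  qed
  then show ?thesis
    by (intro critical_threshold_le[OF game]) auto
qed

end
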